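(* Let $X_2=\mathbb{N}\times\{0,1\}$ with the metric $$d_2\bigl((n,i),(n',j)\bigr)=\begin{cases}0,&(n,i)=(n',j),\\ 1,&(n,i)\ne(n',j)\text{ and }n=n',\\ 2,&n\ne n'.\end{cases}$$ Then the hyperspace $\mathcal{K}(X_2)$ is not plastic; that is, there exists a nonexpansive bijection of $\mathcal{K}(X_2)$ onto itself that is not an isometry.
   Context: For a metric space $X$, $\mathcal{K}(X)$ is the set of all nonempty compact subsets of $X$ with the Hausdorff metric $d_H(A,B)=\max\{\sup_{a\in A}d(a,B),\sup_{b\in B}d(b,A)\}$. A map $f$ is nonexpansive if $d(f(x),f(y))\le d(x,y)$ for all $x,y$. A metric space is plastic if every bijective nonexpansive self-map is an isometry. *)

theory Defs
  imports "HOL-Analysis.Analysis"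
begin

text \<open>Maps between abstract metric spaces are only constrained on the carrier.\<close>

definition nonexpansive_map :: "'a metric \<Rightarrow> 'b metric \<Rightarrow> ('a \<Rightarrow> 'b) \<Rightarrow> bool" where
  "nonexpansive_map m1 m2 f \<longleftrightarrow> f \<in> mspace m1 \<rightarrow> mspace m2 \<and>
     (\<forall>x\<in>mspace m1. \<forall>y\<in>mspace m1. mdist m2 (f x) (f y) \<le> mdist m1 x y)"

definition isometry_map :: "'a metric \<Rightarrow> 'b metric \<Rightarrow> ('a \<Rightarrow> 'b) \<Rightarrow> bool" where
  "isometry_map m1 m2 f \<longleftrightarrow> bij_betw f (mspace m1) (mspace m2) \<and>
     (\<forall>x\<in>mspace m1. \<forall>y\<in>mspace m1. mdist m2 (f x) (f y) = mdist m1 x y)"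

definition plastic :: "'a metric \<Rightarrow> bool" where
  "plastic m \<longleftrightarrow> (\<forall>f. bij_betw f (mspace m) (mspace m) \<and> nonexpansive_map m m f
     \<longrightarrow> isometry_map m m f)"

definition nonempty_compacts :: "'a metric \<Rightarrow> 'a set set" where
  "nonempty_compacts m = {A. A \<noteq> {} \<and> compactin (mtopology_of m) A}"

definition mdist_to_set :: "'a metric \<Rightarrow> 'a \<Rightarrow> 'a set \<Rightarrow> real" where
  "mdist_to_set m x A = (INF a\<in>A. mdist m x a)"

text \<open>The type \<open>'a metric\<close> requires distance functions to be nonnegative and symmetric also
  off the carrier, hence the value 0 there.\<close>

definition hausdorff_mdist :: "'a metric \<Rightarrow> 'a set \<Rightarrow> 'a set \<Rightarrow> real" where
  "hausdorff_mdist m A B =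
     (if A \<in> nonempty_compacts m \<and> B \<in> nonempty_compacts m
      then max (SUP a\<in>A. mdist_to_set m a B) (SUP b\<in>B. mdist_to_set m b A)
      else 0)"

definition hyperspace :: "'a metric \<Rightarrow> 'a set metric" where
  "hyperspace m = metric (nonempty_compacts m, hausdorff_mdist m)"

text \<open>The constructor \<open>metric\<close> is only meaningful on metric spaces, so the following establishes that
  \<open>hyperspace m\<close> really has the intended carrier and distance.\<close>

lemma nonempty_compactsD:
  assumes "A \<in> nonempty_compacts m"
  shows "A \<noteq> {}" "A \<subseteq> mspace m" "closedin (mtopology_of m) A"
    "Metric_space.mbounded (mspace m) (mdist m) A"
proof -
  interpret Metric_space "mspace m" "mdist m" by simp
  have *: "A \<noteq> {}" "compactin mtopology A"
    using assms by (auto simp: nonempty_compacts_def mtopology_of_def)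
  show "A \<noteq> {}" "A \<subseteq> mspace m" "closedin (mtopology_of m) A" "mbounded A"
    using * compactin_subset_topspace[OF *(2)] compactin_imp_closedin[OF Hausdorff_space_mtopology *(2)]
      compactin_imp_mbounded[OF *(2)]
    by (auto simp: mtopology_of_def)
qed

lemma mdist_to_set_bdd_below [simp]: "bdd_below (mdist m x ` A)"
  by (rule bdd_belowI2[where m = 0]) simp

lemma mdist_to_set_nonneg: "A \<noteq> {} \<Longrightarrow> 0 \<le> mdist_to_set m x A"
  unfolding mdist_to_set_def by (rule cINF_greatest) auto

lemma mdist_to_set_le: "a \<in> A \<Longrightarrow> mdist_to_set m x A \<le> mdist m x a"
  unfolding mdist_to_set_def by (rule cINF_lower) auto

lemma mdist_to_set_self:
  assumes "a \<in> A" "A \<subseteq> mspace m"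
  shows "mdist_to_set m a A = 0"
proof (rule antisym)
  have "mdist m a a = 0" using assms by (simp add: subset_iff)
  then show "mdist_to_set m a A \<le> 0"
    using mdist_to_set_le[OF assms(1), of m a] by simp
  show "0 \<le> mdist_to_set m a A"
    using assms(1) by (intro mdist_to_set_nonneg) blast
qed

lemma mdist_to_set_eq_0D:
  assumes "mdist_to_set m x A = 0" "A \<noteq> {}" "closedin (mtopology_of m) A" "x \<in> mspace m"
  shows "x \<in> A"
proof (rule ccontr)
  interpret Metric_space "mspace m" "mdist m" by simp
  assume "x \<notin> A"
  with assms(3,4) obtain r where r: "r > 0" "disjnt A (mball x r)"
    unfolding mtopology_of_def closedin_metric by blast
  have "A \<subseteq> mspace m"
    using assms(3) closedin_subset by fastforce
  then have "r \<le> mdist m x a" if "a \<in> A" for a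
    using r(2) that assms(4) unfolding disjnt_iff in_mball by (meson not_less subsetD)
  then have "r \<le> mdist_to_set m x A"
    unfolding mdist_to_set_def using assms(2) by (intro cINF_greatest) auto
  with r assms(1) show False by simp
qed

lemma mdist_to_set_triangle:
  assumes "x \<in> mspace m" "y \<in> mspace m" "A \<subseteq> mspace m" "A \<noteq> {}"
  shows "mdist_to_set m x A \<le> mdist m x y + mdist_to_set m y A"
proof -
  have "mdist_to_set m x A - mdist m x y \<le> mdist_to_set m y A"
    unfolding mdist_to_set_def[of m y]
  proof (rule cINF_greatest[OF assms(4)])
    fix a assume "a \<in> A"
    then show "mdist_to_set m x A - mdist m x y \<le> mdist m y a"
      using mdist_to_set_le[of a A m x] mdist_triangle[of x m y a] assms by auto
  qed
  then show ?thesis by simp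
qed

lemma mdist_to_set_bdd_above:
  assumes "A \<in> nonempty_compacts m" "B \<in> nonempty_compacts m"
  shows "bdd_above ((\<lambda>a. mdist_to_set m a B) ` A)"
proof -
  interpret Metric_space "mspace m" "mdist m" by simp
  note A = nonempty_compactsD[OF assms(1)] and B = nonempty_compactsD[OF assms(2)]
  from B(1) obtain b where b: "b \<in> B" by auto
  have "mbounded (insert b A)"
    using A(4) B(2) b unfolding mbounded_insert by blast
  then obtain r where r: "\<And>a. a \<in> A \<Longrightarrow> mdist m b a \<le> r"
    unfolding mbounded_alt by blast
  show ?thesis
  proof (rule bdd_aboveI2)
    fix a assume "a \<in> A"
    then show "mdist_to_set m a B \<le> r"
      using mdist_to_set_le[OF b, of m a] r[of a] mdist_commute[of m a b] by simp
  qed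
qed

lemma hausdorff_mdist_le_iff:
  assumes "A \<in> nonempty_compacts m" "B \<in> nonempty_compacts m"
  shows "hausdorff_mdist m A B \<le> r \<longleftrightarrow>
    (\<forall>a\<in>A. mdist_to_set m a B \<le> r) \<and> (\<forall>b\<in>B. mdist_to_set m b A \<le> r)"
  using assms mdist_to_set_bdd_above[OF assms] mdist_to_set_bdd_above[OF assms(2,1)]
    nonempty_compactsD(1)[OF assms(1)] nonempty_compactsD(1)[OF assms(2)]
  by (simp add: hausdorff_mdist_def cSUP_le_iff)

lemma Metric_space_hyperspace: "Metric_space (nonempty_compacts m) (hausdorff_mdist m)"
proof
  show nonneg: "0 \<le> hausdorff_mdist m A B" for A B
  proof (cases "A \<in> nonempty_compacts m \<and> B \<in> nonempty_compacts m")
    case True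
    then have AB: "A \<in> nonempty_compacts m" "B \<in> nonempty_compacts m" by auto
    obtain a where a: "a \<in> A" using nonempty_compactsD(1)[OF AB(1)] by auto
    have "0 \<le> mdist_to_set m a B"
      by (rule mdist_to_set_nonneg[OF nonempty_compactsD(1)[OF AB(2)]])
    also have "\<dots> \<le> hausdorff_mdist m A B"
      using a hausdorff_mdist_le_iff[OF AB, of "hausdorff_mdist m A B"] by simp
    finally show ?thesis .
  qed (auto simp: hausdorff_mdist_def)
  show "hausdorff_mdist m A B = hausdorff_mdist m B A" for A B
    by (simp add: hausdorff_mdist_def max.commute)
  show "hausdorff_mdist m A B = 0 \<longleftrightarrow> A = B"
    if AB: "A \<in> nonempty_compacts m" "B \<in> nonempty_compacts m" for A B
  proof
    note A = nonempty_compactsD[OF AB(1)] and B = nonempty_compactsD[OF AB(2)]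
    assume "hausdorff_mdist m A B = 0"
    then have le0: "\<forall>a\<in>A. mdist_to_set m a B \<le> 0" "\<forall>b\<in>B. mdist_to_set m b A \<le> 0"
      using hausdorff_mdist_le_iff[OF AB, of 0] by simp_all
    have "\<forall>a\<in>A. mdist_to_set m a B = 0" "\<forall>b\<in>B. mdist_to_set m b A = 0"
      using le0 mdist_to_set_nonneg[OF A(1), of m] mdist_to_set_nonneg[OF B(1), of m]
      by (simp_all add: order_antisym)
    then show "A = B"
      using mdist_to_set_eq_0D[OF _ A(1,3)] mdist_to_set_eq_0D[OF _ B(1,3)] A(2) B(2)
      by (intro equalityI subsetI) (simp_all add: subset_iff)
  next
    assume "A = B"
    then have "hausdorff_mdist m A B \<le> 0"
      using mdist_to_set_self[OF _ nonempty_compactsD(2)[OF AB(2)]]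
      unfolding hausdorff_mdist_le_iff[OF AB] by simp
    then show "hausdorff_mdist m A B = 0"
      using nonneg[of A B] by simp
  qed
  have half: "mdist_to_set m a C \<le> hausdorff_mdist m A B + hausdorff_mdist m B C"
    if "A \<in> nonempty_compacts m" "B \<in> nonempty_compacts m" "C \<in> nonempty_compacts m" "a \<in> A"
    for A B C a
  proof -
    note A = nonempty_compactsD[OF that(1)] and B = nonempty_compactsD[OF that(2)]
      and C = nonempty_compactsD[OF that(3)]
    have "mdist_to_set m a C - hausdorff_mdist m B C \<le> mdist_to_set m a B"
      unfolding mdist_to_set_def[of m a B]
    proof (rule cINF_greatest[OF B(1)])
      fix b assume b: "b \<in> B"
      have "mdist_to_set m b C \<le> hausdorff_mdist m B C"
        using hausdorff_mdist_le_iff[OF that(2,3), of "hausdorff_mdist m B C"] b by simp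
      moreover have "mdist_to_set m a C \<le> mdist m a b + mdist_to_set m b C"
        using A(2) B(2) C(1,2) b that(4) by (intro mdist_to_set_triangle) blast+
      ultimately show "mdist_to_set m a C - hausdorff_mdist m B C \<le> mdist m a b"
        by simp
    qed
    moreover have "mdist_to_set m a B \<le> hausdorff_mdist m A B"
      using hausdorff_mdist_le_iff[OF that(1,2), of "hausdorff_mdist m A B"] that(4) by simp
    ultimately show ?thesis by simp
  qed
  have comm: "hausdorff_mdist m A B = hausdorff_mdist m B A" for A B
    by (simp add: hausdorff_mdist_def max.commute)
  show "hausdorff_mdist m A C \<le> hausdorff_mdist m A B + hausdorff_mdist m B C"
    if "A \<in> nonempty_compacts m" "B \<in> nonempty_compacts m" "C \<in> nonempty_compacts m" for A B C
  proof -
    have "mdist_to_set m c A \<le> hausdorff_mdist m A B + hausdorff_mdist m B C" if "c \<in> C" for c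
      using half[OF \<open>C \<in> nonempty_compacts m\<close> \<open>B \<in> nonempty_compacts m\<close>
          \<open>A \<in> nonempty_compacts m\<close> that]
      unfolding comm[of C B] comm[of B A] by linarith
    then show ?thesis
      using half[OF that] unfolding hausdorff_mdist_le_iff[OF that(1,3)] by blast
  qed
qed

lemma mspace_hyperspace [simp]: "mspace (hyperspace m) = nonempty_compacts m"
  and mdist_hyperspace [simp]: "mdist (hyperspace m) = hausdorff_mdist m"
  by (simp_all add: hyperspace_def Metric_space.mspace_metric Metric_space.mdist_metric
      Metric_space_hyperspace)

fun d2 :: "nat \<times> nat \<Rightarrow> nat \<times> nat \<Rightarrow> real" where
  "d2 (n, i) (n', j) = (if (n, i) = (n', j) then 0 else if n = n' then 1 else 2)"

definition X2 :: "(nat \<times> nat) metric" where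
  "X2 = metric (UNIV \<times> {0, 1}, d2)"

lemma Metric_space_X2: "Metric_space (UNIV \<times> {0, 1}) d2"
  by unfold_locales (auto split: if_splits)

lemma mspace_X2 [simp]: "mspace X2 = UNIV \<times> {0, 1}"
  and mdist_X2 [simp]: "mdist X2 = d2"
  unfolding X2_def
  by (rule Metric_space.mspace_metric[OF Metric_space_X2]
      Metric_space.mdist_metric[OF Metric_space_X2])+

end

theory Submission
  imports Defs
begin

text \<open>
  The compact subsets of the discrete space \<^term>\<open>X2\<close> are its finite subsets, and the Hausdorff
  distance of two distinct ones is \<open>1\<close> if they have the same projection to the naturals and \<open>2\<close>
  otherwise (\<open>hausdorff_mdist_X2\<close>). Call the sets with a given projection \<open>F\<close> the fibre over \<open>F\<close>.
  A bijection of the hyperspace is therefore nonexpansive as soon as it sends each fibre into a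
  fibre, and it fails to be an isometry if it merges two fibres.

  The fibre over \<open>F\<close> has \<open>3 ^ card F\<close> elements, because over each point of \<open>F\<close> a nonempty subset of
  \<open>{0, 1}\<close> is chosen. So three fibres of size 3 exactly fill one fibre of size 9, and as there are
  infinitely many fibres of either size, a Hilbert hotel argument gives a merging bijection. The
  fibres over \<open>{0}\<close>, \<open>{1}\<close>, \<open>{2}\<close> are sent onto the fibre over \<open>{0, 1}\<close> (\<open>bij_betw_merge\<close>). To cover
  all singletons again, the fibre over \<open>{n + 3}\<close> is moved to the one over \<open>{n}\<close>; to make room over
  \<open>{0, 1}\<close>, the fibre over \<open>{0, n}\<close> with \<open>n > 0\<close> is moved to the one over \<open>{0, n + 1}\<close>. All other
  fibres stay put (\<open>bij_betw_relabel\<close>).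
\<close>

section \<open>The Hausdorff distance on the hyperspace\<close>

lemma mdist_to_set_le_iff_finite:
  assumes "finite B" "B \<noteq> {}"
  shows "mdist_to_set m x B \<le> r \<longleftrightarrow> (\<exists>b\<in>B. mdist m x b \<le> r)"
  using assms by (simp add: mdist_to_set_def cInf_eq_Min Min_le_iff)

lemma mtopology_of_X2: "mtopology_of X2 = discrete_topology (UNIV \<times> {0, 1})"
proof -
  interpret Metric_space "UNIV \<times> {0, 1}" d2 by (rule Metric_space_X2)
  have "openin mtopology {x}" if "x \<in> UNIV \<times> {0, 1}" for x
  proof -
    have "mball x 1 = {x}"
      unfolding mball_def using that by (auto split: if_splits)
    then show ?thesis
      by (metis openin_mball)
  qed
  then show ?thesis
    by (subst eq_commute) (simp add: discrete_topology_unique mtopology_of_def del: One_nat_def)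
qed

definition fibres :: "nat set set \<Rightarrow> (nat \<times> nat) set set" where
  "fibres \<F> = {A. A \<subseteq> UNIV \<times> {0, 1} \<and> fst ` A \<in> \<F>}"

abbreviation bases :: "nat set set" where
  "bases \<equiv> {F. finite F \<and> F \<noteq> {}}"

lemma nonempty_compacts_X2: "nonempty_compacts X2 = fibres bases"
proof -
  have "finite A \<longleftrightarrow> finite (fst ` A)" if "A \<subseteq> UNIV \<times> {0, 1::nat}" for A :: "(nat \<times> nat) set"
  proof
    assume "finite (fst ` A)"
    moreover have "A \<subseteq> fst ` A \<times> {0, 1}"
      using that by force
    ultimately show "finite A"
      by (meson finite.emptyI finite.insertI finite_SigmaI finite_subset)
  qed simp
  then show ?thesis
    by (auto simp: nonempty_compacts_def mtopology_of_X2 compactin_discrete_topology fibres_def)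
qed

lemma finite_fibres: "A \<in> fibres bases \<Longrightarrow> finite A \<and> A \<noteq> {}"
  unfolding nonempty_compacts_X2[symmetric]
  by (auto simp: nonempty_compacts_def mtopology_of_X2 compactin_discrete_topology)

lemma d2_le_iff: "0 \<le> r \<Longrightarrow> d2 x y \<le> r \<longleftrightarrow> x = y \<or> 1 \<le> r \<and> fst x = fst y \<or> 2 \<le> r"
  by (cases x; cases y) auto

text \<open>Between finite sets the infima are attained, so the distance is at most \<open>r\<close> iff each point of
  either set has a point of the other within \<open>r\<close>. For \<open>1 \<le> r < 2\<close> such points are those with the
  same first coordinate.\<close>

lemma hausdorff_mdist_X2:
  assumes "A \<in> fibres bases" "B \<in> fibres bases"
  shows "hausdorff_mdist X2 A B = (if A = B then 0 else if fst ` A = fst ` B then 1 else 2)"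
proof -
  have fin: "finite A" "A \<noteq> {}" "finite B" "B \<noteq> {}"
    using assms by (auto dest: finite_fibres)
  have le: "hausdorff_mdist X2 A B \<le> r \<longleftrightarrow>
      (\<forall>a\<in>A. \<exists>b\<in>B. d2 a b \<le> r) \<and> (\<forall>b\<in>B. \<exists>a\<in>A. d2 b a \<le> r)" for r
    using assms fin
    by (simp add: hausdorff_mdist_le_iff nonempty_compacts_X2 mdist_to_set_le_iff_finite)
  have nonneg: "0 \<le> hausdorff_mdist X2 A B"
    using Metric_space.nonneg[OF Metric_space_hyperspace] .
  have le_iff: "hausdorff_mdist X2 A B \<le> r \<longleftrightarrow> A = B \<or> 1 \<le> r \<and> fst ` A = fst ` B \<or> 2 \<le> r"
    if "0 \<le> r" for r
  proof -
    consider "2 \<le> r" | "1 \<le> r" "r < 2" | "r < 1" by linarith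
    then show ?thesis
    proof cases
      case 1
      then show ?thesis using fin that by (auto simp: le d2_le_iff)
    next
      case 2
      then have "hausdorff_mdist X2 A B \<le> r \<longleftrightarrow>
          (\<forall>a\<in>A. \<exists>b\<in>B. fst a = fst b) \<and> (\<forall>b\<in>B. \<exists>a\<in>A. fst b = fst a)"
        by (auto simp: le d2_le_iff)
      also have "\<dots> \<longleftrightarrow> fst ` A = fst ` B"
        unfolding set_eq_iff image_iff by metis
      finally show ?thesis using 2 by auto
    next
      case 3
      then show ?thesis using that by (auto simp: le d2_le_iff)
    qed
  qed
  show ?thesis
  proof (rule antisym)
    show "hausdorff_mdist X2 A B \<le> (if A = B then 0 else if fst ` A = fst ` B then 1 else 2)"
      by (auto simp: le_iff)
    show "(if A = B then 0 else if fst ` A = fst ` B then 1 else 2) \<le> hausdorff_mdist X2 A B"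
      using le_iff[OF nonneg] nonneg by auto
  qed
qed

section \<open>Moving fibres by relabelling\<close>

text \<open>A choice of an injection on each \<open>F\<close> moves the fibre over \<open>F\<close> bijectively onto the fibre over
  the image of \<open>F\<close>. So a bijection between families of base sets lifts to the fibres.\<close>

lemma bij_betw_fibres:
  assumes bij: "bij_betw (\<lambda>F. \<phi> F ` F) \<F> \<G>"
    and inj: "\<And>F. F \<in> \<F> \<Longrightarrow> inj_on (\<phi> F) F"
  shows "bij_betw (\<lambda>A. apfst (\<phi> (fst ` A)) ` A) (fibres \<F>) (fibres \<G>)"
proof -
  have fst_image: "fst ` apfst f ` A = f ` fst ` A" for f :: "nat \<Rightarrow> nat" and A :: "(nat \<times> nat) set"
    by force
  have inj': "inj_on (apfst (\<phi> F)) (F \<times> UNIV)" if "F \<in> \<F>" for F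
    using inj[OF that] by (auto simp: inj_on_def)
  show ?thesis
    unfolding bij_betw_def
  proof
    show "inj_on (\<lambda>A. apfst (\<phi> (fst ` A)) ` A) (fibres \<F>)"
    proof (rule inj_onI)
      fix A B assume A: "A \<in> fibres \<F>" and B: "B \<in> fibres \<F>"
        and eq: "apfst (\<phi> (fst ` A)) ` A = apfst (\<phi> (fst ` B)) ` B"
      have F: "fst ` A \<in> \<F>" "fst ` B \<in> \<F>"
        using A B by (auto simp: fibres_def)
      have "\<phi> (fst ` A) ` fst ` A = \<phi> (fst ` B) ` fst ` B"
        using arg_cong[OF eq, of "image fst"] unfolding fst_image .
      then have same: "fst ` A = fst ` B"
        using F bij_betw_imp_inj_on[OF bij, THEN inj_onD] by blast
      have sub: "C \<subseteq> fst ` C \<times> UNIV" for C :: "(nat \<times> nat) set"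
        by force
      show "A = B"
      proof (rule inj_on_image_eq_iff[OF inj'[OF F(1)], THEN iffD1])
        show "A \<subseteq> fst ` A \<times> UNIV" "B \<subseteq> fst ` A \<times> UNIV"
          using sub[of A] sub[of B] by (simp_all only: same)
        show "apfst (\<phi> (fst ` A)) ` A = apfst (\<phi> (fst ` A)) ` B"
          using eq by (simp only: same)
      qed
    qed
  next
    show "(\<lambda>A. apfst (\<phi> (fst ` A)) ` A) ` fibres \<F> = fibres \<G>"
    proof (intro equalityI subsetI)
      fix B assume "B \<in> (\<lambda>A. apfst (\<phi> (fst ` A)) ` A) ` fibres \<F>"
      then obtain A where A: "A \<in> fibres \<F>" "B = apfst (\<phi> (fst ` A)) ` A"
        by auto
      then have "fst ` B \<in> \<G>"
        using bij by (auto simp: fst_image fibres_def bij_betw_def)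
      moreover have "B \<subseteq> UNIV \<times> {0, 1}"
        using A by (fastforce simp: fibres_def)
      ultimately show "B \<in> fibres \<G>"
        by (simp add: fibres_def)
    next
      fix B assume B: "B \<in> fibres \<G>"
      then obtain F where F: "F \<in> \<F>" "\<phi> F ` F = fst ` B"
        using bij by (auto simp: fibres_def bij_betw_def)
      define A where "A = {(n, i). n \<in> F \<and> (\<phi> F n, i) \<in> B}"
      have fst_A: "fst ` A = F"
      proof (intro equalityI subsetI)
        fix n assume "n \<in> F"
        then have "\<phi> F n \<in> fst ` B" using F(2) by blast
        then show "n \<in> fst ` A"
          using \<open>n \<in> F\<close> by (force simp: A_def)
      qed (auto simp: A_def)
      have "A \<in> fibres \<F>"
        using B F(1) fst_A by (auto simp: fibres_def A_def)
      moreover have "apfst (\<phi> F) ` A = B"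
      proof (intro equalityI subsetI)
        fix y assume y: "y \<in> B"
        then obtain n where n: "n \<in> F" "fst y = \<phi> F n"
          using F(2) by (metis image_eqI imageE)
        then have "y = (\<phi> F n, snd y)"
          by (simp add: prod_eq_iff)
        with y n(1) show "y \<in> apfst (\<phi> F) ` A"
          by (intro image_eqI[of _ _ "(n, snd y)"]) (simp_all add: A_def)
      qed (auto simp: A_def)
      ultimately show "B \<in> (\<lambda>A. apfst (\<phi> (fst ` A)) ` A) ` fibres \<F>"
        using fst_A by auto
    qed
  qed
qed

text \<open>The two shifts of the Hilbert hotel. Subtracting \<open>3\<close> is the inverse of \<open>n \<mapsto> n + 3\<close> on the
  singletons other than \<open>{0}\<close>, \<open>{1}\<close>, \<open>{2}\<close>.\<close>

definition relabel :: "nat set \<Rightarrow> nat \<Rightarrow> nat" where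
  "relabel F n = (if card F = 1 then n - 3 else if card F = 2 \<and> 0 \<in> F \<and> n \<noteq> 0 then Suc n else n)"

abbreviation merged :: "nat set set" where
  "merged \<equiv> {{0}, {1}, {2}}"

lemma inj_on_relabel: "inj_on (relabel F) F"
  by (auto simp: inj_on_def relabel_def card_1_singleton_iff)

text \<open>The cardinality of \<open>F\<close>, and for pairs also the membership of \<open>0\<close>, survive relabelling. They
  determine how \<open>F\<close> was relabelled, which gives injectivity.\<close>

lemma bij_betw_relabel: "bij_betw (\<lambda>F. relabel F ` F) (bases - merged) (bases - {{0, 1}})"
  unfolding bij_betw_def
proof
  have card: "card (relabel F ` F) = card F" for F
    by (rule card_image[OF inj_on_relabel])
  have zero: "0 \<in> relabel F ` F \<longleftrightarrow> 0 \<in> F" if "card F = 2" for F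
    using that by (auto simp: relabel_def image_iff)
  show "inj_on (\<lambda>F. relabel F ` F) (bases - merged)"
  proof (rule inj_onI)
    fix F G assume F: "F \<in> bases - merged" and G: "G \<in> bases - merged"
      and eq: "relabel F ` F = relabel G ` G"
    have c: "card F = card G"
      using card eq by metis
    show "F = G"
    proof (cases "card F = 1")
      case True
      then obtain a b where ab: "F = {a}" "G = {b}"
        using c by (metis card_1_singletonE)
      then have "3 \<le> a" "3 \<le> b"
        using F G by (auto simp: numeral_eq_Suc not_less_eq_eq le_Suc_eq)
      then show ?thesis
        using ab eq by (auto simp: relabel_def)
    next
      case False
      have "card F = 2 \<Longrightarrow> 0 \<in> F \<longleftrightarrow> 0 \<in> G"
        using zero c eq by metis
      then have same: "relabel F = relabel G"
        using False c by (auto simp: relabel_def fun_eq_iff)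
      have "inj (relabel G)"
        using False c by (auto simp: inj_def relabel_def)
      then show ?thesis
        using eq same by (simp add: inj_image_eq_iff)
    qed
  qed
  show "(\<lambda>F. relabel F ` F) ` (bases - merged) = bases - {{0, 1}}"
  proof (intro equalityI subsetI)
    fix H assume "H \<in> (\<lambda>F. relabel F ` F) ` (bases - merged)"
    then obtain F where F: "F \<in> bases" and H: "H = relabel F ` F"
      by auto
    have "H \<noteq> {0, 1}"
    proof
      assume H01: "H = {0, 1}"
      then have "card F = 2" "0 \<in> F"
        using card[of F] zero[of F] H by auto
      then have "1 \<notin> relabel F ` F"
        by (auto simp: relabel_def)
      then show False using H H01 by auto
    qed
    then show "H \<in> bases - {{0, 1}}"
      using F H by auto
  next
    fix H :: "nat set" assume H: "H \<in> bases - {{0, 1}}"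
    show "H \<in> (\<lambda>F. relabel F ` F) ` (bases - merged)"
    proof (cases "card H = 1")
      case True
      then obtain n where "H = {n}" by (metis card_1_singletonE)
      then show ?thesis
        by (intro image_eqI[of _ _ "{n + 3}"]) (auto simp: relabel_def)
    next
      case not1: False
      show ?thesis
      proof (cases "card H = 2 \<and> 0 \<in> H")
        case True
        then obtain n where n: "H = {0, n}" "n \<noteq> 0"
          by (auto simp: card_2_iff doubleton_eq_iff)
        then have "n \<noteq> 1" using H by auto
        then obtain k where "n = Suc k" "k \<noteq> 0"
          using n by (cases n) auto
        then show ?thesis
          using n by (intro image_eqI[of _ _ "{0, k}"]) (auto simp: relabel_def doubleton_eq_iff)
      next
        case False
        then have "relabel H = id"
          using not1 by (auto simp: relabel_def fun_eq_iff)
        then show ?thesis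
          using H not1 by (intro image_eqI[of _ _ H]) auto
      qed
    qed
  qed
qed

section \<open>Merging three fibres\<close>

text \<open>An enumeration of the nonempty subsets of \<open>{0, 1}\<close> by \<open>0\<close>, \<open>1\<close>, \<open>2\<close>.\<close>

definition nth_subset :: "nat \<Rightarrow> nat set" where
  "nth_subset k = (if k = 2 then {0, 1} else {k})"

text \<open>The set \<open>{k} \<times> S\<close> goes to the set with slice \<open>S\<close> over \<open>1\<close>; the slice over \<open>0\<close> records \<open>k\<close>.\<close>

definition merge :: "(nat \<times> nat) set \<Rightarrow> (nat \<times> nat) set" where
  "merge A = {0} \<times> (\<Union>k\<in>fst ` A. nth_subset k) \<union> {1} \<times> snd ` A"

lemma merge_singleton_Times:
  "S \<noteq> {} \<Longrightarrow> merge ({k} \<times> S) = {0} \<times> nth_subset k \<union> {1} \<times> S"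
  by (auto simp: merge_def)

lemma nonempty_subset_01: "S \<subseteq> {0, 1} \<Longrightarrow> S \<noteq> {} \<Longrightarrow> \<exists>k\<in>{0, 1, 2}. S = nth_subset k"
  by (auto simp: nth_subset_def)

lemma merged_fibresE:
  assumes "A \<in> fibres merged"
  obtains k S where "k \<in> {0, 1, 2}" "S \<subseteq> {0, 1}" "S \<noteq> {}" "A = {k} \<times> S"
proof -
  from assms obtain k where k: "k \<in> {0, 1, 2}" "fst ` A = {k}" and sub: "A \<subseteq> UNIV \<times> {0, 1}"
    by (auto simp: fibres_def)
  have "A = {k} \<times> snd ` A"
    using k(2) by force
  moreover have "snd ` A \<subseteq> {0, 1}" "snd ` A \<noteq> {}"
    using k(2) sub by auto
  ultimately show ?thesis
    using that k(1) by metis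
qed

lemma bij_betw_merge: "bij_betw merge (fibres merged) (fibres {{0, 1}})"
  unfolding bij_betw_def
proof
  show "inj_on merge (fibres merged)"
  proof (rule inj_onI)
    fix A B assume A: "A \<in> fibres merged" and B: "B \<in> fibres merged" and eq: "merge A = merge B"
    obtain k S where k: "k \<in> {0, 1, 2}" "S \<noteq> {}" "A = {k} \<times> S"
      using merged_fibresE[OF A] by metis
    obtain l T where l: "l \<in> {0, 1, 2}" "T \<noteq> {}" "B = {l} \<times> T"
      using merged_fibresE[OF B] by metis
    have eq': "{0::nat} \<times> nth_subset k \<union> {1} \<times> S = {0} \<times> nth_subset l \<union> {1} \<times> T"
      using eq unfolding k(3) l(3) merge_singleton_Times[OF k(2)] merge_singleton_Times[OF l(2)] .
    have "nth_subset k = nth_subset l" "S = T"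
      using arg_cong[OF eq', of "\<lambda>C. C `` {0}"] arg_cong[OF eq', of "\<lambda>C. C `` {1}"]
      by (simp_all add: Image_def)
    moreover from this have "k = l"
      using k(1) l(1) by (auto simp: nth_subset_def split: if_splits)
    ultimately show "A = B"
      using k l by simp
  qed
  show "merge ` fibres merged = fibres {{0, 1}}"
  proof (intro equalityI subsetI)
    fix B assume "B \<in> merge ` fibres merged"
    then obtain A where A: "A \<in> fibres merged" "B = merge A"
      by blast
    from A(1) obtain k S where "k \<in> {0, 1, 2}" "S \<subseteq> {0, 1}" "S \<noteq> {}" "A = {k} \<times> S"
      by (rule merged_fibresE)
    with A(2) have "k \<in> {0, 1, 2}" "S \<subseteq> {0, 1}" "S \<noteq> {}"
        "B = {0} \<times> nth_subset k \<union> {1} \<times> S"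
      by (simp_all add: merge_singleton_Times)
    then show "B \<in> fibres {{0, 1}}"
      by (auto simp: fibres_def nth_subset_def image_Un)
  next
    fix B assume "B \<in> fibres {{0, 1}}"
    then have sub: "B \<subseteq> UNIV \<times> {0, 1}" and fst_B: "fst ` B = {0, 1}"
      by (auto simp: fibres_def)
    have ne: "B `` {j} \<noteq> {}" if "j \<in> {0, 1}" for j
    proof -
      have "j \<in> fst ` B" using that fst_B by simp
      then show ?thesis by force
    qed
    have slice: "B `` {j} \<subseteq> {0, 1}" for j
      using sub by auto
    obtain k where k: "k \<in> {0, 1, 2}" "B `` {0} = nth_subset k"
      using nonempty_subset_01[OF slice ne, of 0] by auto
    have "fst b \<in> {0, 1}" if "b \<in> B" for b
      using fst_B that by blast
    then have "B = {0} \<times> B `` {0} \<union> {1} \<times> B `` {1}"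
      by fastforce
    also have "\<dots> = merge ({k} \<times> B `` {1})"
      using ne[of 1] k(2) by (simp add: merge_singleton_Times)
    finally have "B = merge ({k} \<times> B `` {1})" .
    moreover have "{k} \<times> B `` {1} \<in> fibres merged"
      using k(1) slice[of 1] ne[of 1] by (auto simp: fibres_def)
    ultimately show "B \<in> merge ` fibres merged"
      by blast
  qed
qed

section \<open>The merging bijection\<close>

definition collapse :: "(nat \<times> nat) set \<Rightarrow> (nat \<times> nat) set" where
  "collapse A = (if A \<in> fibres merged then merge A else apfst (relabel (fst ` A)) ` A)"

lemma bij_betw_collapse: "bij_betw collapse (fibres bases) (fibres bases)"
proof -
  have "bij_betw collapse (fibres merged) (fibres {{0, 1}})"
    by (subst bij_betw_cong[where g = merge]) (simp add: collapse_def, rule bij_betw_merge)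
  moreover have "bij_betw collapse (fibres (bases - merged)) (fibres (bases - {{0, 1}}))"
    by (subst bij_betw_cong[where g = "\<lambda>A. apfst (relabel (fst ` A)) ` A"])
      (simp add: collapse_def fibres_def, rule bij_betw_fibres[OF bij_betw_relabel inj_on_relabel])
  moreover have "fibres {{0, 1}} \<inter> fibres (bases - {{0, 1}}) = {}"
    by (auto simp: fibres_def)
  ultimately have bij: "bij_betw collapse (fibres merged \<union> fibres (bases - merged))
      (fibres {{0, 1}} \<union> fibres (bases - {{0, 1}}))"
    by (rule bij_betw_combine)
  have union: "fibres \<F> \<union> fibres (bases - \<F>) = fibres bases" if "\<F> \<subseteq> bases" for \<F>
    using that unfolding fibres_def by blast
  have "merged \<subseteq> bases" "{{0, 1}} \<subseteq> bases"
    by auto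
  from bij[unfolded this[THEN union]] show ?thesis .
qed

lemma fst_collapse_merged:
  assumes "A \<in> fibres merged"
  shows "fst ` collapse A = {0, 1}"
proof -
  have "merge A \<in> fibres {{0, 1}}"
    using bij_betwE[OF bij_betw_merge] assms by blast
  then have "fst ` merge A = {0, 1}"
    by (simp add: fibres_def)
  then show ?thesis
    using assms by (simp only: collapse_def if_True)
qed

text \<open>Fibres are sent into fibres, so distance \<open>1\<close> is never stretched to \<open>2\<close>.\<close>

lemma fst_collapse_cong:
  assumes "A \<in> fibres bases" "B \<in> fibres bases" "fst ` A = fst ` B"
  shows "fst ` collapse A = fst ` collapse B"
proof (cases "fst ` A \<in> merged")
  case True
  then have "A \<in> fibres merged" "B \<in> fibres merged"
    using assms by (auto simp: fibres_def)
  then show ?thesis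
    by (simp add: fst_collapse_merged)
next
  case False
  have "fst ` apfst f ` C = f ` fst ` C" for f :: "nat \<Rightarrow> nat" and C :: "(nat \<times> nat) set"
    by force
  then show ?thesis
    using False assms by (simp add: collapse_def fibres_def)
qed

theorem theorem2p8:
  shows "\<not> plastic (hyperspace X2) \<and>
    (\<exists>f. bij_betw f (mspace (hyperspace X2)) (mspace (hyperspace X2)) \<and>
         nonexpansive_map (hyperspace X2) (hyperspace X2) f \<and>
         \<not> isometry_map (hyperspace X2) (hyperspace X2) f)"
proof -
  have carrier: "mspace (hyperspace X2) = fibres bases"
    by (simp add: nonempty_compacts_X2)
  have bij: "bij_betw collapse (mspace (hyperspace X2)) (mspace (hyperspace X2))"
    unfolding carrier by (rule bij_betw_collapse)
  have mem: "collapse A \<in> fibres bases" if "A \<in> fibres bases" for A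
    using bij_betwE[OF bij_betw_collapse] that by blast
  have nonexp: "nonexpansive_map (hyperspace X2) (hyperspace X2) collapse"
    unfolding nonexpansive_map_def carrier mdist_hyperspace
  proof (intro conjI ballI)
    show "collapse \<in> fibres bases \<rightarrow> fibres bases"
      using mem by blast
    fix A B assume AB: "A \<in> fibres bases" "B \<in> fibres bases"
    show "hausdorff_mdist X2 (collapse A) (collapse B) \<le> hausdorff_mdist X2 A B"
      using fst_collapse_cong[OF AB]
      unfolding hausdorff_mdist_X2[OF AB] hausdorff_mdist_X2[OF AB[THEN mem]]
      by simp
  qed
  have "\<not> isometry_map (hyperspace X2) (hyperspace X2) collapse"
  proof
    assume iso: "isometry_map (hyperspace X2) (hyperspace X2) collapse"
    \<comment> \<open>two sets from different fibres that are merged\<close>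
    define A B :: "(nat \<times> nat) set" where "A = {(0, 0)}" and "B = {(1, 0)}"
    have AB: "A \<in> fibres merged" "B \<in> fibres merged" "A \<in> fibres bases" "B \<in> fibres bases"
      by (auto simp: A_def B_def fibres_def)
    have "hausdorff_mdist X2 (collapse A) (collapse B) = hausdorff_mdist X2 A B"
      using iso AB(3,4) unfolding isometry_map_def carrier mdist_hyperspace by blast
    moreover have "hausdorff_mdist X2 A B = 2"
      using AB(3,4) by (simp add: hausdorff_mdist_X2) (simp add: A_def B_def)
    moreover have "hausdorff_mdist X2 (collapse A) (collapse B) \<le> 1"
      using AB mem by (simp add: hausdorff_mdist_X2 fst_collapse_merged)
    ultimately show False
      by simp
  qed
  with bij nonexp show ?thesis
    unfolding plastic_def by blast
qed

end
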